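(* Let $q$ be a power of an odd prime with $q \equiv 3 \pmod 4$, and let $D$ be a multiplicative character on $\mathbb{F}_q$. For $j \in \mathbb{F}_q^*$ let $$R(D,j) = \sum_{z \in \mathbb{F}_{q^2},\ N(z) = j^4} M_8(z)\,\overline{D}(N(1-z)).$$ Then for $j = \pm 1$, $$R(D,j) = -\overline{D}(4) J(\phi D^2, \phi),$$ and for all other $j \in \mathbb{F}_q^*$, $$R(D,j) = -\phi(j)\, q\, \overline{D}^4(j-1)\ {}_2F_1\left( \begin{array}{r|} D, D^2\phi \\ D\phi \end{array} \ -\left(\frac{j+1}{j-1}\right)^2 \right).$$
   Context: All multiplicative characters (including the trivial character $\varepsilon$) are complex-valued and are extended to map $0$ to $0$. $\phi$ denotes the quadratic character on $\mathbb{F}_q$, and a bar over a character denotes complex conjugation. $N z = z \cdot z^q \in \mathbb{F}_q$ is the norm of $z \in \mathbb{F}_{q^2}$. $M_8$ is a fixed multiplicative character of order $8$ on $\mathbb{F}_{q^2}$. The Jacobi sum over $\mathbb{F}_q$ is $J(A,B) = \sum_{y \in \mathbb{F}_q} A(y)B(1-y)$. For characters $A,B,C$ on $\mathbb{F}_q$ and $x \in \mathbb{F}_q$, the hypergeometric function over $\mathbb{F}_q$ is $${}_2F_1\left( \begin{array}{r|} A,B \\ C \end{array} \ x \right) = \frac{\varepsilon(x)}{q}\sum_{y \in \mathbb{F}_q} B(y)\,\overline{B}C(y-1)\,\overline{A}(1-xy),$$ where $\overline{B}C(y-1)$ means $(\overline{B}C)(y-1)$. *)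

theory Defs
  imports
    Complex_Main
    "HOL-Library.Cardinality"
    "HOL-Computational_Algebra.Primes"
begin

(* Multiplicative characters, always (also the trivial one) extended by 0 at 0. *)

definition mult_char :: "('a::field \<Rightarrow> complex) \<Rightarrow> bool" where
  "mult_char \<chi> \<longleftrightarrow> \<chi> 0 = 0 \<and> \<chi> 1 = 1 \<and> (\<forall>x y. \<chi> (x * y) = \<chi> x * \<chi> y)"

definition triv_char :: "'a::field \<Rightarrow> complex" where
  "triv_char x = (if x = 0 then 0 else 1)"

definition quad_char :: "'a::field \<Rightarrow> complex" where
  "quad_char x = (if x = 0 then 0 else if \<exists>y. x = y ^ 2 then 1 else - 1)"

definition char_mult :: "('a::field \<Rightarrow> complex) \<Rightarrow> ('a \<Rightarrow> complex) \<Rightarrow> 'a \<Rightarrow> complex" where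
  "char_mult A B = (\<lambda>x. A x * B x)"

(* The factor triv_char makes the zeroth power the trivial character, vanishing at 0. *)
definition char_pow :: "('a::field \<Rightarrow> complex) \<Rightarrow> nat \<Rightarrow> 'a \<Rightarrow> complex" where
  "char_pow A n = (\<lambda>x. triv_char x * A x ^ n)"

definition char_conj :: "('a::field \<Rightarrow> complex) \<Rightarrow> 'a \<Rightarrow> complex" where
  "char_conj A = (\<lambda>x. cnj (A x))"

definition char_order :: "('a::field \<Rightarrow> complex) \<Rightarrow> nat" where
  "char_order A = (LEAST n. n > 0 \<and> char_pow A n = triv_char)"

definition jacobi_sum ::
    "('a::{field,finite} \<Rightarrow> complex) \<Rightarrow> ('a \<Rightarrow> complex) \<Rightarrow> complex" where
  "jacobi_sum A B = (\<Sum>y\<in>UNIV. A y * B (1 - y))"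

definition hyp2F1 :: "('a::{field,finite} \<Rightarrow> complex) \<Rightarrow> ('a \<Rightarrow> complex) \<Rightarrow>
    ('a \<Rightarrow> complex) \<Rightarrow> 'a \<Rightarrow> complex" where
  "hyp2F1 A B C x = triv_char x / of_nat CARD('a) *
     (\<Sum>y\<in>UNIV. B y * char_mult (char_conj B) C (y - 1) * char_conj A (1 - x * y))"

(* The types 'a and 'b play the roles of F_q and its quadratic extension; the inclusion
   is an explicit ring homomorphism, automatically injective as 'a is a field. *)

definition field_embedding :: "('a::field \<Rightarrow> 'b::field) \<Rightarrow> bool" where
  "field_embedding \<iota> \<longleftrightarrow> \<iota> 1 = 1 \<and>
     (\<forall>x y. \<iota> (x + y) = \<iota> x + \<iota> y) \<and> (\<forall>x y. \<iota> (x * y) = \<iota> x * \<iota> y)"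

(* the_inv is legitimate here when CARD('b) = CARD('a)^2: then z * z^q is a root of
   X^q - X, and these roots are exactly the range of the embedding. *)
definition quad_norm :: "('a::{field,finite} \<Rightarrow> 'b::{field,finite}) \<Rightarrow> 'b \<Rightarrow> 'a" where
  "quad_norm \<iota> z = the_inv \<iota> (z * z ^ CARD('a))"

definition R_sum :: "('a::{field,finite} \<Rightarrow> 'b::{field,finite}) \<Rightarrow> ('b \<Rightarrow> complex) \<Rightarrow>
    ('a \<Rightarrow> complex) \<Rightarrow> 'a \<Rightarrow> complex" where
  "R_sum \<iota> M8 D j = (\<Sum>z | quad_norm \<iota> z = j ^ 4. M8 z * char_conj D (quad_norm \<iota> (1 - z)))"

end

theory Submission
  imports Defs "HOL-Computational_Algebra.Polynomial"
begin

text \<open>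
  Write \<open>\<phi>\<close> for the quadratic character of \<open>F\<^sub>q\<close>, \<open>E\<close> for the conjugate of \<open>D\<close> and \<open>N\<close> for the norm.
  Since \<open>q mod 4 = 3\<close>, the element \<open>-1\<close> is not a square in \<open>F\<^sub>q\<close>, so the extension is \<open>F\<^sub>q(i)\<close>
  with \<open>i\<^sup>2 = -1\<close>. Its Frobenius map is \<open>a + i b \<mapsto> a - i b\<close>, hence \<open>N (a + i b) = a\<^sup>2 + b\<^sup>2\<close>, and the
  elements of norm one are the points of the unit circle over \<open>F\<^sub>q\<close>.

  Substituting \<open>z = j\<^sup>2 u\<close> turns \<open>R(D, j)\<close> into the sum of \<open>M\<^sub>8(u) E(N(1 - j\<^sup>2 u))\<close> over the elements
  \<open>u\<close> of norm one. The fourth power of \<open>M\<^sub>8\<close> is the quadratic character of the extension, that is,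
  \<open>\<phi> \<circ> N\<close>. With \<open>w = 1 + u\<close> one has \<open>u = w / w\<^sup>q\<close> for \<open>u \<noteq> -1\<close>, and then \<open>q mod 4 = 3\<close> yields
  \<open>M\<^sub>8(u)\<^sup>2 = M\<^sub>8(w)\<^sup>4 = \<phi>(N(1 + u)) = \<phi>(2 + 2 a)\<close>, where \<open>a\<close> is the real part of \<open>u\<close>
  (\<open>M8_square_norm_1\<close>). This sign is \<open>1\<close> exactly when \<open>u\<close> is a square in the norm-one group. For
  the other \<open>u\<close> the values \<open>M\<^sub>8(u)\<close> and \<open>M\<^sub>8(1/u)\<close> cancel, and for the squares \<open>u = v\<^sup>2\<close> they are
  \<open>M\<^sub>8(v)\<^sup>2\<close>, which is again given by \<open>\<phi>\<close> (\<open>sum_norm_1_group_squares\<close>). So everything descends to a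
  sum over the circle whose terms depend only on the real part \<open>a\<close> of \<open>v\<close>. There are
  \<open>1 + \<phi>(1 - a\<^sup>2)\<close> points above \<open>a\<close>, and the symmetry \<open>a \<mapsto> -a\<close> makes the two summands of this count
  contribute equally. The result, \<open>R_sum_eq_base_field_sum\<close>, is
    \<open>R(D, j) = (\<Sum>a. \<phi>(2 + 2 a) E((1 + j\<^sup>2)\<^sup>2 - 4 j\<^sup>2 a\<^sup>2))\<close>.

  The argument of \<open>E\<close> is a product of two linear factors in \<open>a\<close>. If \<open>j \<noteq> \<plusminus>1\<close>, the Moebius substitution
  that sends \<open>a = -1\<close> to infinity, infinity to \<open>0\<close> and the root of one factor to \<open>1\<close> gives the
  hypergeometric sum (\<open>hyp2F1_eq\<close>).
  If \<open>j = \<plusminus>1\<close>, the argument is \<open>4 (1 - a\<^sup>2)\<close>, and the Jacobi sum appears after replacing the sum by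
  one with \<open>E\<^sup>2\<close>: both are half of the same sum over the circle, because
  \<open>2 (1 + a) (1 + b) = (1 + a + b)\<^sup>2\<close> on the circle lets one exchange the roles of \<open>a\<close> and \<open>b\<close>
  (\<open>sum_quad_char_doubling\<close>).
\<close>

section \<open>The quadratic character of a finite field\<close>

text \<open>Translation by \<open>1\<close> permutes the field, so it does not change the sum of all its elements.\<close>
lemma of_nat_CARD_eq_0: "of_nat CARD('a::{field,finite}) = (0::'a)"
proof -
  have "(\<Sum>x\<in>UNIV. x + 1) = (\<Sum>x\<in>UNIV. x :: 'a)"
    by (rule sum.reindex_bij_witness[of _ "\<lambda>x. x - 1" "\<lambda>x. x + 1"]) auto
  then show ?thesis
    by (simp add: sum.distrib)
qed

lemma two_neq_0:
  assumes "odd CARD('a::{field,finite})"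
  shows "(2::'a) \<noteq> 0"
proof
  assume "(2::'a) = 0"
  then have "of_nat CARD('a) = (1::'a)"
    using assms by (auto elim!: oddE)
  then show False
    by (simp add: of_nat_CARD_eq_0)
qed

text \<open>Multiplication by \<open>x\<close> permutes the nonzero elements, so it does not change their product.\<close>
lemma power_CARD_minus_1:
  fixes x :: "'a::{field,finite}"
  assumes "x \<noteq> 0"
  shows "x ^ (CARD('a) - 1) = 1"
proof -
  have "(\<Prod>y\<in>UNIV-{0}. x * y) = (\<Prod>y\<in>UNIV-{0}. y)"
    by (rule prod.reindex_bij_witness[of _ "\<lambda>y. y / x" "\<lambda>y. x * y"]) (use assms in auto)
  moreover have "(\<Prod>y\<in>UNIV-{0}. y :: 'a) \<noteq> 0"
    by simp
  ultimately show ?thesis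
    by (simp add: prod.distrib card_Diff_singleton)
qed

lemma quad_char_0 [simp]: "quad_char 0 = 0"
  by (simp add: quad_char_def)

lemma quad_char_eq_0_iff [simp]: "quad_char x = 0 \<longleftrightarrow> x = 0"
  by (simp add: quad_char_def)

lemma quad_char_square [simp]: "quad_char (x^2) = triv_char x"
  by (auto simp: quad_char_def triv_char_def)

lemma quad_char_self [simp]: "quad_char x * quad_char x = triv_char x"
  by (auto simp: quad_char_def triv_char_def)

lemma quad_char_inverse: "quad_char (inverse x) = quad_char x"
proof -
  have "(\<exists>y. inverse x = y^2) \<longleftrightarrow> (\<exists>y. x = y^2)"
    by (metis inverse_inverse_eq power_inverse)
  then show ?thesis
    by (simp add: quad_char_def)
qed

lemma square_roots_eq: "{y. y^2 = (x::'a::idom)^2} = {x, -x}"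
  by (auto simp: power2_eq_iff)

lemma card_square_roots:
  fixes x :: "'a::{field,finite}"
  assumes "odd CARD('a)"
  shows "of_nat (card {y. y^2 = x}) = 1 + quad_char x"
proof (cases "\<exists>y. x = y^2")
  case True
  then obtain y where y: "x = y^2" by blast
  have "y = -y \<longleftrightarrow> y = 0"
    using two_neq_0[OF assms] by (metis add.inverse_neutral add_eq_0_iff mult_2 mult_eq_0_iff)
  then have "card {y, -y} = 2" if "y \<noteq> 0"
    using that by (metis card_2_iff)
  then have "card {y, -y} = (if y = 0 then 1 else 2)"
    by simp
  then show ?thesis
    by (simp add: y square_roots_eq triv_char_def)
next
  case False
  then have "{y. y^2 = x} = {}" by auto
  with False show ?thesis
    by (auto simp: quad_char_def)
qed

lemma euler_criterion:
  fixes x :: "'a::{field,finite}"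
  assumes odd: "odd CARD('a)" and "x \<noteq> 0"
  shows "(\<exists>y. x = y^2) \<longleftrightarrow> x ^ ((CARD('a) - 1) div 2) = 1"
proof -
  define n where "n = (CARD('a) - 1) div 2"
  define S where "S = (\<lambda>y::'a. y^2) ` (UNIV - {0})"
  define T where "T = {x::'a. x ^ n = 1}"
  have n: "CARD('a) - 1 = 2 * n"
    unfolding n_def using odd by auto
  have "CARD('a) > 1"
    using card_mono[of UNIV "{0, 1::'a}"] by simp
  then have "n > 0"
    using n by simp
  \<comment> \<open>The nonzero squares \<open>S\<close> lie among the roots \<open>T\<close> of \<open>X\<^sup>n - 1\<close>. As \<open>S\<close> has \<open>n\<close> elements and
    \<open>T\<close> at most \<open>n\<close>, the two sets agree.\<close>
  have "S \<subseteq> T"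
  proof -
    have "y ^ (2 * n) = 1" if "y \<noteq> 0" for y :: 'a
      using power_CARD_minus_1[OF that] n by simp
    then show ?thesis
      by (auto simp: S_def T_def simp flip: power_mult)
  qed
  have deg: "degree (monom 1 n + [:-1:] :: 'a poly) = n"
    using \<open>n > 0\<close> by (subst degree_add_eq_left) (auto simp: degree_monom_eq)
  then have "(monom 1 n + [:-1:] :: 'a poly) \<noteq> 0"
    using \<open>n > 0\<close> by auto
  from card_poly_roots_bound[OF this] have "card T \<le> n"
    by (simp add: deg T_def poly_monom)
  have "card {y. y^2 = s} = 2" if "s \<in> S" for s
  proof -
    have "quad_char s = 1"
      using that by (auto simp: S_def quad_char_def)
    then have "of_nat (card {y. y^2 = s}) = (of_nat 2 :: complex)"
      by (simp add: card_square_roots[OF odd])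
    then show ?thesis
      by (simp only: of_nat_eq_iff)
  qed
  then have "card (\<Union>s\<in>S. {y. y^2 = s}) = 2 * card S"
    by (subst card_UN_disjoint) auto
  also have "(\<Union>s\<in>S. {y. y^2 = s}) = UNIV - {0}"
    by (auto simp: S_def)
  finally have "card S = n"
    using n by (simp add: card_Diff_singleton)
  then have "S = T"
    using \<open>S \<subseteq> T\<close> \<open>card T \<le> n\<close> by (intro card_seteq) auto
  then have "x \<in> S \<longleftrightarrow> x ^ n = 1"
    by (simp add: T_def)
  moreover have "x \<in> S \<longleftrightarrow> (\<exists>y. x = y^2)"
    using \<open>x \<noteq> 0\<close> by (auto simp: S_def)
  ultimately show ?thesis
    by (simp add: n_def)
qed

lemma power_half_CARD:
  fixes x :: "'a::{field,finite}"
  assumes odd: "odd CARD('a)" and "x \<noteq> 0"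
  shows "x ^ ((CARD('a) - 1) div 2) = 1 \<or> x ^ ((CARD('a) - 1) div 2) = -1"
proof -
  have "(x ^ ((CARD('a) - 1) div 2))^2 = x ^ (CARD('a) - 1)"
    using odd by (simp flip: power_mult)
  then show ?thesis
    using power_CARD_minus_1[OF \<open>x \<noteq> 0\<close>] by (simp add: power2_eq_1_iff)
qed

lemma quad_char_mult:
  fixes x y :: "'a::{field,finite}"
  assumes odd: "odd CARD('a)"
  shows "quad_char (x * y) = quad_char x * quad_char y"
proof (cases "x = 0 \<or> y = 0")
  case False
  have "-1 \<noteq> (1::'a)"
    using two_neq_0[OF odd] by (metis one_add_one add.right_inverse)
  have q: "quad_char z = (if z ^ ((CARD('a) - 1) div 2) = 1 then 1 else -1)" if "z \<noteq> 0" for z :: 'a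
    using euler_criterion[OF odd that] that by (simp add: quad_char_def)
  show ?thesis
    using False power_half_CARD[OF odd, of x] power_half_CARD[OF odd, of y] \<open>-1 \<noteq> (1::'a)\<close>
    by (auto simp: q power_mult_distrib)
qed auto

lemma quad_char_minus_1:
  assumes "CARD('a::{field,finite}) mod 4 = 3"
  shows "quad_char (-1 :: 'a) = -1"
proof -
  have odd: "odd CARD('a)" and half: "odd ((CARD('a) - 1) div 2)"
    using assms by presburger+
  have "-1 \<noteq> (1::'a)"
    using two_neq_0[OF odd] by (metis one_add_one add.right_inverse)
  then show ?thesis
    using euler_criterion[OF odd, of "-1"] half by (auto simp: quad_char_def)
qed

section \<open>Multiplicative characters\<close>

lemma mult_char_0: "mult_char \<chi> \<Longrightarrow> \<chi> 0 = 0"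
  and mult_char_1: "mult_char \<chi> \<Longrightarrow> \<chi> 1 = 1"
  and mult_char_mult: "mult_char \<chi> \<Longrightarrow> \<chi> (x * y) = \<chi> x * \<chi> y"
  by (auto simp: mult_char_def)

lemma mult_char_power: "mult_char \<chi> \<Longrightarrow> \<chi> (x ^ n) = \<chi> x ^ n"
  by (induction n) (auto simp: mult_char_1 mult_char_mult)

lemma mult_char_minus_square: "mult_char \<chi> \<Longrightarrow> \<chi> (- x) ^ 2 = \<chi> x ^ 2"
  by (simp flip: mult_char_power)

lemma mult_char_nonzero:
  assumes "mult_char \<chi>" "x \<noteq> 0"
  shows "\<chi> x \<noteq> 0"
proof -
  have "\<chi> x * \<chi> (inverse x) = 1"
    using assms by (simp add: mult_char_1 flip: mult_char_mult)
  then show ?thesis by auto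
qed

text \<open>Character values at nonzero elements are roots of unity.\<close>
lemma mult_char_cnj:
  fixes x :: "'a::{field,finite}"
  assumes "mult_char \<chi>" "x \<noteq> 0"
  shows "\<chi> x * cnj (\<chi> x) = 1"
proof -
  have "CARD('a) > 1"
    using card_mono[of UNIV "{0, 1::'a}"] by simp
  have "norm (\<chi> x) ^ (CARD('a) - 1) = 1"
    using power_CARD_minus_1[OF assms(2)] assms(1)
    by (simp add: mult_char_1 flip: norm_power mult_char_power)
  then have "norm (\<chi> x) = 1"
    using power_eq_imp_eq_base[of "norm (\<chi> x)" "CARD('a) - 1" 1] \<open>CARD('a) > 1\<close> by simp
  then show ?thesis
    by (simp flip: complex_norm_square)
qed

lemma mult_char_char_conj: "mult_char \<chi> \<Longrightarrow> mult_char (char_conj \<chi>)"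
  by (auto simp: mult_char_def char_conj_def)

lemma char_conj_mult_self:
  fixes x :: "'a::{field,finite}"
  assumes "mult_char \<chi>" "x \<noteq> 0"
  shows "char_conj \<chi> x * \<chi> x = 1"
  using mult_char_cnj[OF assms] by (simp add: char_conj_def mult.commute)

lemma mult_char_inverse:
  fixes x :: "'a::{field,finite}"
  assumes "mult_char \<chi>"
  shows "\<chi> (inverse x) = char_conj \<chi> x"
proof (cases "x = 0")
  case False
  have "\<chi> x * \<chi> (inverse x) = 1"
    using assms False by (simp add: mult_char_1 flip: mult_char_mult)
  then show ?thesis
    using char_conj_mult_self[OF assms False] mult_char_nonzero[OF assms False]
    by (metis mult.commute mult_left_cancel)
qed (use assms in \<open>auto simp: char_conj_def mult_char_0\<close>)

lemma char_order_8:
  fixes M :: "'b::{field,finite} \<Rightarrow> complex"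
  assumes M: "mult_char M" and ord: "char_order M = 8"
  shows "x \<noteq> 0 \<Longrightarrow> M x ^ 8 = 1" and "\<exists>x. x \<noteq> 0 \<and> M x ^ 4 \<noteq> 1"
proof -
  \<comment> \<open>Some positive power of \<open>M\<close> is trivial, so the least such exponent, which defines the order,
    exists and has the properties that make it least.\<close>
  let ?P = "\<lambda>n. n > 0 \<and> char_pow M n = triv_char"
  have "CARD('b) > 1"
    using card_mono[of UNIV "{0, 1::'b}"] by simp
  moreover have "M x ^ (CARD('b) - 1) = 1" if "x \<noteq> 0" for x
    using power_CARD_minus_1[OF that] by (metis mult_char_power[OF M] mult_char_1[OF M])
  ultimately have ex: "?P (CARD('b) - 1)"
    by (auto simp: char_pow_def triv_char_def)
  have "?P 8"
    using LeastI[of ?P, OF ex] ord by (simp add: char_order_def)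
  then show "M x ^ 8 = 1" if "x \<noteq> 0"
    using that by (metis char_pow_def mult_1 triv_char_def)
  have "\<not> ?P 4"
    using not_less_Least[of 4 ?P] ord by (simp add: char_order_def)
  then have "char_pow M 4 \<noteq> triv_char"
    by simp
  then obtain x where "char_pow M 4 x \<noteq> triv_char x"
    by blast
  then show "\<exists>x. x \<noteq> 0 \<and> M x ^ 4 \<noteq> 1"
    by (intro exI[of _ x]) (auto simp: char_pow_def triv_char_def split: if_splits)
qed

text \<open>The fourth power of a character of order eight is a nontrivial character with values \<open>\<plusminus>1\<close>. It is
  \<open>1\<close> on the squares, hence \<open>-1\<close> on some nonsquare \<open>g\<close>, and hence \<open>-1\<close> on every nonsquare \<open>x\<close>, as
  \<open>x g\<close> is a square.\<close>
lemma order_8_power_4: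
  fixes M :: "'b::{field,finite} \<Rightarrow> complex"
  assumes odd: "odd CARD('b)" and M: "mult_char M" and ord: "char_order M = 8" and "x \<noteq> 0"
  shows "M x ^ 4 = quad_char x"
proof -
  have square: "M (y^2) ^ 4 = 1" if "y \<noteq> 0" for y
    using char_order_8(1)[OF M ord that] by (simp add: mult_char_power[OF M] flip: power_mult)
  obtain g where g: "g \<noteq> 0" "M g ^ 4 \<noteq> 1"
    using char_order_8(2)[OF M ord] by blast
  have "(M g ^ 4)^2 = 1"
    using char_order_8(1)[OF M ord g(1)] by (simp flip: power_mult)
  then have g': "M g ^ 4 = -1"
    using g(2) power2_eq_1_iff by blast
  have "quad_char g = -1"
    using g square by (auto simp: quad_char_def split: if_splits)
  show ?thesis
  proof (cases "\<exists>y. x = y^2")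
    case True
    then show ?thesis
      using square \<open>x \<noteq> 0\<close> by (auto simp: quad_char_def)
  next
    case False
    then have x: "quad_char x = -1"
      using \<open>x \<noteq> 0\<close> by (simp add: quad_char_def)
    then have "quad_char (x * g) = 1"
      by (simp add: quad_char_mult[OF odd] \<open>quad_char g = -1\<close>)
    then obtain y where y: "x * g = y^2"
      by (auto simp: quad_char_def split: if_splits)
    then have "y \<noteq> 0"
      using \<open>x \<noteq> 0\<close> g(1) by auto
    with y have "M x ^ 4 * M g ^ 4 = 1"
      using square by (metis mult_char_mult[OF M] power_mult_distrib)
    with g' x show ?thesis
      by (simp add: minus_equation_iff)
  qed
qed

section \<open>Sums over the unit circle\<close>

definition unit_circle :: "('a::field \<times> 'a) set" where
  "unit_circle = {(a, b). a^2 + b^2 = 1}"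

lemma sum_unit_circle:
  fixes g :: "'a::{field,finite} \<Rightarrow> complex"
  assumes odd: "odd CARD('a)"
  shows "(\<Sum>(a, b)\<in>unit_circle. g a) = (\<Sum>a\<in>UNIV. (1 + quad_char (1 - a^2)) * g a)"
proof -
  have "(\<Sum>(a, b)\<in>unit_circle. g a) = (\<Sum>(a, b)\<in>(SIGMA a:UNIV. {b. b^2 = 1 - a^2}). g a)"
    by (intro sum.cong) (auto simp: unit_circle_def eq_diff_eq add.commute)
  also have "\<dots> = (\<Sum>a\<in>UNIV. \<Sum>b | b^2 = 1 - a^2. g a)"
    by (subst sum.Sigma) auto
  finally show ?thesis
    by (simp add: card_square_roots[OF odd])
qed

lemma sum_unit_circle_swap:
  "(\<Sum>(a, b)\<in>unit_circle. f a b) = (\<Sum>(a, b)\<in>unit_circle. f b a)"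
  by (rule sum.reindex_bij_witness[of _ prod.swap prod.swap])
     (auto simp: unit_circle_def add.commute)

text \<open>The left-hand side weights each \<open>a\<close> by the number of points of the unit circle above it. Up to
  squares \<open>(1 - a\<^sup>2) (2 + 2 a)\<close> is \<open>2 - 2 a\<close>, except at \<open>a = -1\<close>, so the two summands of the weight
  are exchanged by \<open>a \<mapsto> -a\<close>. The exceptional point accounts for the correction \<open>h 1\<close>.\<close>
lemma sum_even_quad_char:
  fixes h :: "'a::{field,finite} \<Rightarrow> complex"
  assumes odd: "odd CARD('a)" and even: "\<And>a. h (-a) = h a"
  shows "(\<Sum>a\<in>UNIV. (1 + quad_char (1 - a^2)) * (quad_char (2 + 2 * a) * h a)) =
    2 * (\<Sum>a\<in>UNIV. quad_char (2 + 2 * a) * h a) - h 1"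
proof -
  have "(\<Sum>a\<in>UNIV. quad_char (1 - a^2) * (quad_char (2 + 2 * a) * h a)) =
    (\<Sum>a\<in>UNIV-{-1}. quad_char (2 - 2 * a) * h a)"
  proof (rule sum.mono_neutral_cong_right)
    show "quad_char (1 - a^2) * (quad_char (2 + 2 * a) * h a) = quad_char (2 - 2 * a) * h a"
      if "a \<in> UNIV - {-1}" for a
    proof -
      have "1 + a \<noteq> 0"
        using that by (auto simp: add_eq_0_iff)
      have "(1 - a^2) * (2 + 2 * a) = (1 + a)^2 * (2 - 2 * a)"
        by (simp add: power2_eq_square algebra_simps)
      then have "quad_char (1 - a^2) * quad_char (2 + 2 * a) = quad_char (2 - 2 * a)"
        using \<open>1 + a \<noteq> 0\<close>
        by (simp add: quad_char_mult[OF odd] triv_char_def flip: quad_char_mult[OF odd, of "1 - a^2"])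
      then show ?thesis
        by (metis mult.assoc)
    qed
  qed auto
  also have "\<dots> = (\<Sum>a\<in>UNIV-{1}. quad_char (2 + 2 * a) * h a)"
    by (rule sum.reindex_bij_witness[of _ uminus uminus]) (auto simp: even minus_equation_iff[of _ 1])
  also have "\<dots> = (\<Sum>a\<in>UNIV. quad_char (2 + 2 * a) * h a) - quad_char ((2::'a)^2) * h 1"
    by (simp add: sum_diff1)
  also have "quad_char (2^2 :: 'a) = 1"
    using two_neq_0[OF odd] by (simp only: quad_char_square) (simp add: triv_char_def)
  finally show ?thesis
    by (simp add: distrib_right sum.distrib)
qed

text \<open>The product \<open>(2 + 2 b) (1 + a)\<close> equals \<open>(1 + a + b)\<^sup>2\<close> on the circle.\<close>
lemma quad_char_circle:
  fixes a b :: "'a::{field,finite}"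
  assumes odd: "odd CARD('a)" and circle: "a^2 + b^2 = 1" and "a \<noteq> -1" "b \<noteq> -1"
  shows "quad_char (2 + 2 * b) = quad_char (1 + a)"
proof -
  have ne: "1 + a \<noteq> 0" "1 + b \<noteq> 0"
    using assms(3,4) by (auto simp: add_eq_0_iff)
  have "(1 + a + b)^2 = (1 + (a^2 + b^2)) + 2 * a + 2 * b + 2 * a * b"
    by (simp add: power2_eq_square algebra_simps)
  also have "\<dots> = (2 + 2 * b) * (1 + a)"
    unfolding circle by (simp add: algebra_simps)
  finally have eq: "(2 + 2 * b) * (1 + a) = (1 + a + b)^2" ..
  have "2 + 2 * b = 2 * (1 + b)"
    by simp
  then have "(2 + 2 * b) * (1 + a) \<noteq> 0"
    using ne two_neq_0[OF odd] by (metis mult_eq_0_iff)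
  then have "quad_char (2 + 2 * b) * quad_char (1 + a) = 1"
    unfolding eq quad_char_mult[OF odd, symmetric] by (simp add: triv_char_def)
  then show ?thesis
    by (auto simp: quad_char_def split: if_splits)
qed

text \<open>Twice either side is the sum of \<open>\<phi>(2 + 2 a) E(b)\<^sup>2\<close> over the points \<open>(a, b)\<close> of the unit circle. For
  the left-hand side one counts points above \<open>a\<close>, using \<open>b\<^sup>2 = 1 - a\<^sup>2\<close>. For the right-hand side one
  replaces \<open>\<phi>(2 + 2 a)\<close> by \<open>\<phi>(1 + b)\<close> and counts points above \<open>b\<close>. In terms of Gauss sums this is an
  instance of the Hasse-Davenport product formula for the quadratic character.\<close>
lemma sum_quad_char_doubling:
  fixes E :: "'a::{field,finite} \<Rightarrow> complex"
  assumes odd: "odd CARD('a)" and E: "mult_char E"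
  shows "(\<Sum>a\<in>UNIV. quad_char (2 + 2 * a) * E (1 - a^2)) = (\<Sum>a\<in>UNIV. quad_char (1 + a) * E a ^ 2)"
proof -
  have two: "quad_char (2::'a) * quad_char (2::'a) = 1"
    using two_neq_0[OF odd] by (simp add: triv_char_def)
  have "quad_char (2 + 2 * a) = quad_char (2::'a) * quad_char (1 + a)" for a :: 'a
    by (simp add: distrib_left flip: quad_char_mult[OF odd])
  then have shift: "quad_char (1 + a) = quad_char (2 + 2 * a) * quad_char (2::'a)" for a :: 'a
    using two by (simp add: mult_ac)
  have E_minus: "E (-a) ^ 2 = E a ^ 2" for a
    by (rule mult_char_minus_square[OF E])
  have "2 * (\<Sum>a\<in>UNIV. quad_char (2 + 2 * a) * E (1 - a^2)) =
    (\<Sum>a\<in>UNIV. (1 + quad_char (1 - a^2)) * (quad_char (2 + 2 * a) * E (1 - a^2)))"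
    by (subst sum_even_quad_char[OF odd]) (simp_all add: mult_char_0[OF E])
  also have "\<dots> = (\<Sum>(a, b)\<in>unit_circle. quad_char (2 + 2 * a) * E (1 - a^2))"
    by (simp add: sum_unit_circle[OF odd])
  also have "\<dots> = (\<Sum>(a, b)\<in>unit_circle. quad_char (2 + 2 * a) * E b ^ 2)"
  proof (intro sum.cong refl, clarify)
    fix a b :: 'a
    assume "(a, b) \<in> unit_circle"
    then have "1 - a^2 = b^2"
      by (auto simp: unit_circle_def algebra_simps)
    then show "quad_char (2 + 2 * a) * E (1 - a^2) = quad_char (2 + 2 * a) * E b ^ 2"
      by (simp add: mult_char_power[OF E])
  qed
  also have "\<dots> = (\<Sum>(a, b)\<in>unit_circle. quad_char (2 + 2 * b) * E a ^ 2)"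
    by (rule sum_unit_circle_swap)
  \<comment> \<open>The exchange fails only at the point \<open>(-1, 0)\<close>, whose contribution \<open>\<phi>(2)\<close> is added by hand. At
    \<open>(0, -1)\<close> both terms vanish.\<close>
  also have "\<dots> = (\<Sum>(a, b)\<in>unit_circle. quad_char (1 + a) * E a ^ 2 +
      (if a = -1 then quad_char (2::'a) else 0))"
  proof (intro sum.cong refl, clarify)
    fix a b :: 'a
    assume "(a, b) \<in> unit_circle"
    then have circle: "a^2 + b^2 = 1"
      by (simp add: unit_circle_def)
    consider "a = -1" | "a = 0" | "a \<noteq> -1" "a \<noteq> 0" by blast
    then show "quad_char (2 + 2 * b) * E a ^ 2 =
      quad_char (1 + a) * E a ^ 2 + (if a = -1 then quad_char (2::'a) else 0)"
    proof cases
      case 1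
      then have "b = 0" using circle by simp
      with 1 show ?thesis
        by (simp add: E_minus mult_char_1[OF E])
    next
      case 2
      then show ?thesis by (auto simp: mult_char_0[OF E])
    next
      case 3
      then have "b \<noteq> -1" using circle by auto
      with 3 show ?thesis
        using quad_char_circle[OF odd circle] by simp
    qed
  qed
  also have "\<dots> = (\<Sum>a\<in>UNIV. (1 + quad_char (1 - a^2)) *
      (quad_char (1 + a) * E a ^ 2 + (if a = -1 then quad_char (2::'a) else 0)))"
    by (rule sum_unit_circle[OF odd])
  also have "\<dots> = (\<Sum>a\<in>UNIV. (1 + quad_char (1 - a^2)) *
      (quad_char (2 + 2 * a) * (quad_char (2::'a) * E a ^ 2)) + (if a = -1 then quad_char (2::'a) else 0))"
    by (intro sum.cong) (auto simp: shift mult.assoc)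
  also have "\<dots> = (\<Sum>a\<in>UNIV. (1 + quad_char (1 - a^2)) *
      (quad_char (2 + 2 * a) * (quad_char (2::'a) * E a ^ 2))) + quad_char (2::'a)"
    by (simp add: sum.distrib)
  also have "\<dots> = 2 * (\<Sum>a\<in>UNIV. quad_char (1 + a) * E a ^ 2)"
    by (subst sum_even_quad_char[OF odd]) (simp_all add: E_minus mult_char_1[OF E] shift mult.assoc)
  finally show ?thesis
    by simp
qed

section \<open>The Jacobi sum and the hypergeometric sum\<close>

text \<open>The substitution is \<open>y = -1/b\<close>; the sign is \<open>\<phi>(-1)\<close>.\<close>
lemma jacobi_sum_eq:
  fixes D :: "'a::{field,finite} \<Rightarrow> complex"
  assumes card: "CARD('a) mod 4 = 3" and D: "mult_char D"
  shows "jacobi_sum (char_mult quad_char (char_pow D 2)) quad_char =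
    - (\<Sum>b\<in>UNIV. quad_char (1 + b) * char_conj D b ^ 2)"
proof -
  have odd: "odd CARD('a)"
    using card by presburger
  have "jacobi_sum (char_mult quad_char (char_pow D 2)) quad_char =
    (\<Sum>y\<in>UNIV-{0}. quad_char y * D y ^ 2 * quad_char (1 - y))"
    unfolding jacobi_sum_def char_mult_def char_pow_def
    by (rule sum.mono_neutral_cong_right) (auto simp: triv_char_def)
  also have "\<dots> = (\<Sum>b\<in>UNIV-{0}. - (quad_char (1 + b) * char_conj D b ^ 2))"
  proof (rule sum.reindex_bij_witness[of _ "\<lambda>b. - inverse b" "\<lambda>y. - inverse y"])
    fix y :: 'a
    assume "y \<in> UNIV - {0}"
    then have [simp]: "y \<noteq> 0" by simp
    have "y * (1 - y) = y^2 * - (1 + - inverse y)"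
      by (simp add: power2_eq_square field_simps)
    then have "quad_char y * quad_char (1 - y) = quad_char (y^2 * (-1 * (1 + - inverse y)))"
      by (simp flip: quad_char_mult[OF odd])
    also have "\<dots> = - quad_char (1 + - inverse y)"
      by (simp only: quad_char_mult[OF odd] quad_char_minus_1[OF card] quad_char_square)
        (simp add: triv_char_def)
    finally have "quad_char y * quad_char (1 - y) = - quad_char (1 + - inverse y)" .
    moreover have "char_conj D (- inverse y) ^ 2 = D y ^ 2"
      using mult_char_inverse[OF mult_char_char_conj[OF D], of y]
      by (simp add: mult_char_minus_square[OF mult_char_char_conj[OF D]]) (simp add: char_conj_def)
    ultimately have "- (quad_char (1 + - inverse y) * char_conj D (- inverse y) ^ 2) =
      (quad_char y * quad_char (1 - y)) * D y ^ 2"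
      by simp
    then show "- (quad_char (1 + - inverse y) * char_conj D (- inverse y) ^ 2) =
      quad_char y * D y ^ 2 * quad_char (1 - y)"
      by (simp only: mult_ac)
  qed auto
  also have "\<dots> = (\<Sum>b\<in>UNIV. - (quad_char (1 + b) * char_conj D b ^ 2))"
    by (rule sum.mono_neutral_left) (auto simp: char_conj_def mult_char_0[OF D])
  finally show ?thesis
    by (simp add: sum_negf)
qed

text \<open>Both sums are taken over a projective line with four marked points, at which the summand ramifies:
  \<open>-1\<close>, infinity and the two roots of \<open>(1 + j\<^sup>2)\<^sup>2 - 4 j\<^sup>2 a\<^sup>2\<close> on the left, infinity, \<open>0\<close>, \<open>1 / x\<close> and
  \<open>1\<close> on the right, where \<open>x\<close> is the hypergeometric argument. A Moebius map matches them, and the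
  factor \<open>- \<phi>(j) E(j - 1)\<^sup>4\<close> comes from the constants pulled out of the characters.\<close>
lemma hyp2F1_eq:
  fixes D :: "'a::{field,finite} \<Rightarrow> complex"
  assumes card: "CARD('a) mod 4 = 3" and D: "mult_char D"
    and j: "j \<noteq> 0" "j \<noteq> 1" "j \<noteq> -1"
  shows "(\<Sum>a\<in>UNIV. quad_char (2 + 2 * a) * char_conj D ((1 + j^2)^2 - 4 * j^2 * a^2)) =
    - quad_char j * of_nat CARD('a) * char_pow (char_conj D) 4 (j - 1) *
      hyp2F1 D (char_mult (char_pow D 2) quad_char) (char_mult D quad_char)
        (- (((j + 1) / (j - 1)) ^ 2))"
proof -
  have odd: "odd CARD('a)"
    using card by presburger
  note two = two_neq_0[OF odd]
  define E where "E = char_conj D"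
  have E: "mult_char E"
    unfolding E_def by (rule mult_char_char_conj[OF D])
  have E_inverse: "E (inverse y) = D y" for y
    using mult_char_inverse[OF E, of y] by (simp add: E_def char_conj_def)
  define x where "x = - (((j + 1) / (j - 1))^2)"
  have j': "j - 1 \<noteq> 0" "j + 1 \<noteq> 0"
    using j by (auto simp: eq_neg_iff_add_eq_0)
  then have "x \<noteq> 0"
    by (simp add: x_def)
  \<comment> \<open>\<open>t\<close> is the inverse of the substitution \<open>y = - (j - 1)\<^sup>2 / (2 j (1 + a))\<close>, which maps the roots
    \<open>a = (1 + j\<^sup>2) / (2 j)\<close> and \<open>a = - (1 + j\<^sup>2) / (2 j)\<close> to \<open>1 / x\<close> and \<open>1\<close>.\<close>
  define t where "t y = - ((j - 1)^2 / (2 * j * y)) - 1" for y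
  have t_inv: "- ((j - 1)^2 / (2 * j * (1 + a))) \<noteq> 0"
    "t (- ((j - 1)^2 / (2 * j * (1 + a)))) = a" if "a \<noteq> -1" for a
    using that j j' two by (auto simp: t_def add_eq_0_iff)
  have term_eq: "quad_char (2 + 2 * t y) * E ((1 + j^2)^2 - 4 * j^2 * (t y)^2) =
    - quad_char j * E (j - 1) ^ 4 *
      (char_mult (char_pow D 2) quad_char y *
       char_mult (char_conj (char_mult (char_pow D 2) quad_char)) (char_mult D quad_char) (y - 1) *
       E (1 - x * y))" if y: "y \<noteq> 0" for y
  proof -
    have "2 + 2 * t y = -1 * (((j - 1)^2 * inverse j) * inverse y)"
      using y j(1) two by (simp add: t_def field_simps)
    then have "quad_char (2 + 2 * t y) = - quad_char j * quad_char y"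
      using j' by (simp only: quad_char_mult[OF odd] quad_char_minus_1[OF card] quad_char_square
        quad_char_inverse) (simp add: triv_char_def)
    moreover have "E ((1 + j^2)^2 - 4 * j^2 * (t y)^2) = E (j - 1) ^ 4 * E (y - 1) * E (1 - x * y) * D y ^ 2"
    proof -
      have "2 * j * t y = - ((j - 1)^2 / y) - 2 * j"
        using y j(1) two by (simp add: t_def field_simps)
      then have "1 + j^2 + 2 * j * t y = (j - 1)^2 * (y - 1) * inverse y"
        "1 + j^2 - 2 * j * t y = ((j - 1)^2 + (j + 1)^2 * y) * inverse y"
        using y by (simp_all add: field_simps power2_eq_square)
      moreover have "(j - 1)^2 + (j + 1)^2 * y = (j - 1)^2 * (1 - x * y)"
        using j' by (simp add: x_def power_divide algebra_simps)
      moreover have "(1 + j^2)^2 - 4 * j^2 * (t y)^2 = (1 + j^2 + 2 * j * t y) * (1 + j^2 - 2 * j * t y)"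
        by (simp add: power2_eq_square algebra_simps)
      ultimately have "(1 + j^2)^2 - 4 * j^2 * (t y)^2 =
        ((j - 1)^2 * (y - 1) * inverse y) * ((j - 1)^2 * (1 - x * y) * inverse y)"
        by simp
      then show ?thesis
        by (simp add: mult_char_mult[OF E] mult_char_power[OF E] E_inverse power2_eq_square
          power4_eq_xxxx mult_ac)
    qed
    moreover have "char_mult (char_pow D 2) quad_char y = D y ^ 2 * quad_char y"
      using y by (simp add: char_mult_def char_pow_def triv_char_def)
    moreover have "char_mult (char_conj (char_mult (char_pow D 2) quad_char)) (char_mult D quad_char) w = E w"
      for w
    proof (cases "w = 0")
      case False
      have "cnj (quad_char w) * quad_char w = 1"
        using False by (simp add: quad_char_def)
      moreover have "cnj (D w) * D w = 1"
        using mult_char_cnj[OF D False] by (simp add: mult.commute)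
      ultimately have "cnj (D w) * ((cnj (D w) * D w) * (cnj (quad_char w) * quad_char w)) = cnj (D w)"
        by simp
      then show ?thesis
        using False
        by (simp add: char_mult_def char_conj_def char_pow_def triv_char_def E_def power2_eq_square
          mult_ac)
    qed (simp add: char_mult_def mult_char_0[OF E])
    ultimately show ?thesis
      by (simp add: mult_ac)
  qed
  have "(\<Sum>a\<in>UNIV. quad_char (2 + 2 * a) * E ((1 + j^2)^2 - 4 * j^2 * a^2)) =
    (\<Sum>a\<in>UNIV-{-1}. quad_char (2 + 2 * a) * E ((1 + j^2)^2 - 4 * j^2 * a^2))"
    by (rule sum.mono_neutral_right) auto
  also have "\<dots> = (\<Sum>y\<in>UNIV-{0}. quad_char (2 + 2 * t y) * E ((1 + j^2)^2 - 4 * j^2 * (t y)^2))"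
    by (rule sum.reindex_bij_witness[of _ t "\<lambda>a. - ((j - 1)^2 / (2 * j * (1 + a)))"])
      (use t_inv j j' two in \<open>auto simp: t_def\<close>)
  also have "\<dots> = (\<Sum>y\<in>UNIV-{0}. - quad_char j * E (j - 1) ^ 4 *
      (char_mult (char_pow D 2) quad_char y *
       char_mult (char_conj (char_mult (char_pow D 2) quad_char)) (char_mult D quad_char) (y - 1) *
       E (1 - x * y)))"
    by (intro sum.cong) (auto simp: term_eq)
  also have "\<dots> = (\<Sum>y\<in>UNIV. - quad_char j * E (j - 1) ^ 4 *
      (char_mult (char_pow D 2) quad_char y *
       char_mult (char_conj (char_mult (char_pow D 2) quad_char)) (char_mult D quad_char) (y - 1) *
       E (1 - x * y)))"
    by (rule sum.mono_neutral_left) (auto simp: char_mult_def)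
  also have "\<dots> = - quad_char j * of_nat CARD('a) * char_pow (char_conj D) 4 (j - 1) *
      hyp2F1 D (char_mult (char_pow D 2) quad_char) (char_mult D quad_char) x"
    using j' \<open>x \<noteq> 0\<close>
    by (simp add: hyp2F1_def sum_distrib_left E_def char_pow_def triv_char_def mult_ac)
  finally show ?thesis
    by (simp only: E_def x_def)
qed

section \<open>The extension by a square root of minus one\<close>

lemma frobenius_add_prime_power:
  fixes x y :: "'b::{field,finite}"
  assumes "prime p" and "CARD('b) = p ^ m"
  shows "(x + y) ^ (p ^ n) = x ^ (p ^ n) + y ^ (p ^ n)"
proof -
  have prime: "prime CHAR('b)"
    by (rule prime_CHAR_semidom) (simp add: finite_imp_CHAR_pos)
  moreover have "CHAR('b) dvd p ^ m"
    using of_nat_CARD_eq_0[where ?'a = 'b] assms(2) by (metis of_nat_eq_0_iff_char_dvd)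
  ultimately have "p = CHAR('b)"
    using \<open>prime p\<close> by (metis prime_dvd_power primes_dvd_imp_eq)
  then show ?thesis
    using freshmans_dream'[OF prime] by blast
qed

text \<open>The characteristic enters only through the additivity of the map \<open>z \<mapsto> z\<^sup>q\<close>.\<close>
locale gaussian_extension =
  fixes \<iota> :: "'a::{field,finite} \<Rightarrow> 'b::{field,finite}" and i :: 'b
  assumes card_mod_4: "CARD('a) mod 4 = 3"
    and card_ext: "CARD('b) = CARD('a) ^ 2"
    and embedding: "field_embedding \<iota>"
    and frobenius_add: "(x + y :: 'b) ^ CARD('a) = x ^ CARD('a) + y ^ CARD('a)"
    and i_square: "i^2 = -1"
begin

lemma odd_card: "odd CARD('a)"
  using card_mod_4 by presburger

lemma card_eq:
  obtains m where "CARD('a) = 4 * m + 3"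
  using card_mod_4 by (metis mult_div_mod_eq)

lemma odd_card_ext: "odd CARD('b)"
  by (simp add: card_ext odd_card)

lemma emb_1 [simp]: "\<iota> 1 = 1"
  and emb_add: "\<iota> (x + y) = \<iota> x + \<iota> y"
  and emb_mult: "\<iota> (x * y) = \<iota> x * \<iota> y"
  using embedding by (auto simp: field_embedding_def)

lemma emb_0 [simp]: "\<iota> 0 = 0"
  by (metis add_0_left add_cancel_left_left emb_add)

lemma emb_minus: "\<iota> (- x) = - \<iota> x"
  using emb_add[of "- x" x] by (simp add: eq_neg_iff_add_eq_0)

lemma emb_power: "\<iota> (x ^ n) = \<iota> x ^ n"
  by (induction n) (auto simp: emb_mult)

lemma emb_eq_0_iff [simp]: "\<iota> x = 0 \<longleftrightarrow> x = 0"
proof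
  assume "\<iota> x = 0"
  then have "\<iota> (x * inverse x) = 0"
    by (simp add: emb_mult)
  then show "x = 0"
    by (cases "x = 0") auto
qed simp

lemma emb_eq_iff [simp]: "\<iota> x = \<iota> y \<longleftrightarrow> x = y"
  using emb_eq_0_iff[of "x - y"] emb_add[of x "-y"] by (auto simp: emb_minus)

lemma inj_emb: "inj \<iota>"
  by (simp add: inj_on_def)

lemma minus_1_not_square: "x^2 \<noteq> (-1 :: 'a)"
  using quad_char_minus_1[OF card_mod_4] by (auto simp: quad_char_def dest: sym split: if_splits)

definition point :: "'a \<Rightarrow> 'a \<Rightarrow> 'b" where
  "point a b = \<iota> a + i * \<iota> b"

lemma emb_conv_point: "\<iota> a = point a 0"
  by (simp add: point_def)

lemma point_mult: "point a b * point c d = point (a * c - b * d) (a * d + b * c)"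
proof -
  have "point a b * point c d = \<iota> a * \<iota> c + i^2 * (\<iota> b * \<iota> d) + i * (\<iota> a * \<iota> d + \<iota> b * \<iota> c)"
    by (simp add: point_def power2_eq_square algebra_simps)
  also have "\<dots> = point (a * c - b * d) (a * d + b * c)"
    using emb_add[of "a * c" "- (b * d)"]
    by (simp add: i_square point_def emb_add emb_mult emb_minus)
  finally show ?thesis .
qed

lemma point_add: "point a b + point c d = point (a + c) (b + d)"
  by (simp add: point_def emb_add algebra_simps)

lemma point_minus: "- point a b = point (- a) (- b)"
  by (simp add: point_def emb_minus)

text \<open>A nontrivial relation \<open>a + i b = 0\<close> would make \<open>-1 = (a / b)\<^sup>2\<close> a square in the base field.\<close>
lemma point_eq_0_iff: "point a b = 0 \<longleftrightarrow> a = 0 \<and> b = 0"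
proof
  assume eq: "point a b = 0"
  have "b = 0"
  proof (rule ccontr)
    assume "b \<noteq> 0"
    from eq have "\<iota> a = - (i * \<iota> b)"
      by (simp add: point_def eq_neg_iff_add_eq_0)
    then have "\<iota> (a^2) = \<iota> (- (b^2))"
      by (simp add: emb_power emb_minus power_mult_distrib i_square)
    then have "(a / b)^2 = -1"
      using \<open>b \<noteq> 0\<close> by (simp add: power_divide)
    then show False
      using minus_1_not_square by blast
  qed
  with eq show "a = 0 \<and> b = 0"
    by (simp add: point_def)
qed (simp add: point_def)

lemma point_eq_iff [simp]: "point a b = point c d \<longleftrightarrow> a = c \<and> b = d"
  using point_eq_0_iff[of "a - c" "b - d"] point_add[of "a - c" "b - d" c d] by auto

text \<open>Injectivity suffices, since both sides have \<open>q\<^sup>2\<close> elements.\<close>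
lemma bij_point: "bij (\<lambda>(a, b). point a b)"
proof -
  have "inj (\<lambda>(a, b). point a b)"
    by (auto simp: inj_on_def)
  moreover from this have "range (\<lambda>(a, b). point a b) = UNIV"
    by (intro card_subset_eq) (simp_all add: card_image card_ext power2_eq_square)
  ultimately show ?thesis
    by (simp add: bij_def)
qed

lemma point_cases [case_names point]:
  obtains a b where "z = point a b"
proof -
  have "z \<in> range (\<lambda>(a, b). point a b)"
    using bij_point by (simp add: bij_def)
  then show thesis
    using that by auto
qed

text \<open>Frobenius fixes the base field, and \<open>i\<^sup>q = -i\<close> because \<open>q mod 4 = 3\<close>.\<close>
lemma point_conj: "point a b ^ CARD('a) = point a (- b)"
proof -
  have fermat: "x ^ CARD('a) = x" for x :: 'a
  proof (cases "x = 0")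
    case False
    have "x ^ CARD('a) = x * x ^ (CARD('a) - 1)"
      by (simp add: power_eq_if)
    then show ?thesis
      using power_CARD_minus_1[OF False] by simp
  qed (simp add: zero_power)
  obtain m where m: "CARD('a) = 4 * m + 3"
    by (rule card_eq)
  then have "CARD('a) = 2 * (2 * m) + 2 + 1"
    by simp
  then have "i ^ CARD('a) = (i^2) ^ (2 * m) * i^2 * i"
    by (simp only: power_add power_mult power_one_right)
  then have "i ^ CARD('a) = -i"
    by (simp add: i_square)
  then show ?thesis
    by (simp add: point_def frobenius_add power_mult_distrib fermat emb_minus flip: emb_power)
qed

lemma point_mult_conj: "point a b * point a b ^ CARD('a) = \<iota> (a^2 + b^2)"
  by (simp add: point_conj point_mult emb_conv_point power2_eq_square)

lemma quad_norm_point: "quad_norm \<iota> (point a b) = a^2 + b^2"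
  by (simp add: quad_norm_def point_mult_conj the_inv_f_f[OF inj_emb])

lemma emb_quad_norm: "\<iota> (quad_norm \<iota> z) = z ^ (CARD('a) + 1)"
  by (cases z rule: point_cases) (simp add: quad_norm_point point_mult_conj)

lemma quad_norm_mult: "quad_norm \<iota> (x * y) = quad_norm \<iota> x * quad_norm \<iota> y"
proof -
  have "\<iota> (quad_norm \<iota> (x * y)) = \<iota> (quad_norm \<iota> x * quad_norm \<iota> y)"
    by (simp only: emb_quad_norm emb_mult power_mult_distrib)
  then show ?thesis by simp
qed

lemma quad_norm_emb: "quad_norm \<iota> (\<iota> x) = x^2"
  by (simp add: emb_conv_point quad_norm_point)

text \<open>By Euler's criterion in both fields, since raising to the power \<open>(q\<^sup>2 - 1) / 2\<close> is the same as
  raising the norm \<open>z\<^bsup>q + 1\<^esup>\<close> to the power \<open>(q - 1) / 2\<close>.\<close>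
lemma quad_char_quad_norm: "quad_char z = quad_char (quad_norm \<iota> z)"
proof (cases "z = 0")
  case False
  define q where "q = CARD('a)"
  have "quad_norm \<iota> z \<noteq> 0"
    using False emb_quad_norm[of z] by (metis emb_0 power_not_zero)
  have "CARD('b) - 1 = (q + 1) * (q - 1)"
    by (simp add: card_ext q_def algebra_simps power2_eq_square)
  moreover have "even (q - 1)"
    using odd_card by (simp add: q_def)
  ultimately have "(CARD('b) - 1) div 2 = (q + 1) * ((q - 1) div 2)"
    by (simp add: div_mult_swap)
  then have "z ^ ((CARD('b) - 1) div 2) = \<iota> (quad_norm \<iota> z ^ ((q - 1) div 2))"
    by (simp only: power_mult emb_power emb_quad_norm q_def)
  then have "z ^ ((CARD('b) - 1) div 2) = 1 \<longleftrightarrow> quad_norm \<iota> z ^ ((q - 1) div 2) = 1"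
    by (metis emb_1 emb_eq_iff)
  then show ?thesis
    using False \<open>quad_norm \<iota> z \<noteq> 0\<close> euler_criterion[OF odd_card_ext False]
      euler_criterion[OF odd_card \<open>quad_norm \<iota> z \<noteq> 0\<close>]
    by (simp add: quad_char_def q_def)
qed (use quad_norm_emb[of 0] in simp)

section \<open>The norm-one group\<close>

definition norm_1_group :: "'b set" where
  "norm_1_group = {z. quad_norm \<iota> z = 1}"

lemma norm_1_group_nonzero: "u \<in> norm_1_group \<Longrightarrow> u \<noteq> 0"
  using quad_norm_emb[of 0] by (auto simp: norm_1_group_def)

lemma inverse_norm_1:
  assumes "a^2 + b^2 = 1"
  shows "inverse (point a b) = point a (- b)"
proof -
  have "point a b * point a (- b) = point (a^2 + b^2) 0"
    by (simp add: point_mult power2_eq_square)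
  then have "point a b * point a (- b) = 1"
    by (simp add: assms flip: emb_conv_point)
  then show ?thesis
    by (rule inverse_unique)
qed

lemma sum_norm_1_group:
  fixes f :: "'b \<Rightarrow> complex"
  shows "(\<Sum>u\<in>norm_1_group. f u) = (\<Sum>(a, b)\<in>unit_circle. f (point a b))"
proof -
  have "norm_1_group = (\<lambda>(a, b). point a b) ` unit_circle"
  proof (intro equalityI subsetI)
    fix u assume "u \<in> norm_1_group"
    then show "u \<in> (\<lambda>(a, b). point a b) ` unit_circle"
      by (cases u rule: point_cases) (auto simp: norm_1_group_def unit_circle_def quad_norm_point)
  qed (auto simp: norm_1_group_def unit_circle_def quad_norm_point)
  moreover have "inj_on (\<lambda>(a, b). point a b) unit_circle"
    by (auto simp: inj_on_def)
  ultimately show ?thesis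
    by (simp add: sum.reindex case_prod_unfold)
qed

lemma quad_norm_one_minus:
  assumes "a^2 + b^2 = 1"
  shows "quad_norm \<iota> (1 - \<iota> (j^2) * point a b) = 1 - 2 * j^2 * a + j^4"
proof -
  have "1 - \<iota> (j^2) * point a b = point 1 0 + - (point (j^2) 0 * point a b)"
    by (simp flip: emb_conv_point)
  also have "\<dots> = point (1 - j^2 * a) (- (j^2 * b))"
    by (simp only: point_mult point_minus point_add) simp
  finally have "quad_norm \<iota> (1 - \<iota> (j^2) * point a b) = (1 - j^2 * a)^2 + (j^2 * b)^2"
    by (simp add: quad_norm_point)
  also have "\<dots> = 1 - 2 * j^2 * a + j^4 * (a^2 + b^2)"
    by (simp add: power2_eq_square power4_eq_xxxx algebra_simps)
  finally show ?thesis
    by (simp add: assms)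
qed

text \<open>For \<open>u = a + i b\<close> of norm one, \<open>(1 + u)\<^sup>2 = u N(1 + u)\<close> and \<open>N(1 + u) = 2 + 2 a\<close>. If the latter is a
  nonzero square \<open>s\<^sup>2\<close>, then \<open>(1 + u) / s\<close> is a square root of \<open>u\<close> of norm one.\<close>
lemma norm_1_group_square:
  assumes circle: "a^2 + b^2 = 1" and "a = -1 \<or> quad_char (2 + 2 * a) = 1"
  shows "\<exists>v\<in>norm_1_group. v^2 = point a b"
proof (cases "a = -1")
  case True
  then have "b = 0" using circle by simp
  \<comment> \<open>The element is \<open>-1 = i\<^sup>2\<close>.\<close>
  have "quad_norm \<iota> (point 0 1) = 1" "(point 0 1)^2 = point a b"
    using True \<open>b = 0\<close> by (simp_all add: quad_norm_point point_mult power2_eq_square)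
  then show ?thesis
    by (auto simp: norm_1_group_def)
next
  case False
  with assms(2) have char: "quad_char (2 + 2 * a) = 1" by simp
  then obtain s where s: "2 + 2 * a = s^2" "s \<noteq> 0"
    by (auto simp: quad_char_def split: if_splits)
  have "(1 + a)^2 + b^2 = 1 + 2 * a + (a^2 + b^2)"
    by (simp add: power2_eq_square algebra_simps)
  also have "\<dots> = s^2"
    by (simp add: circle flip: s)
  finally have norm: "(1 + a)^2 + b^2 = s^2" .
  have "(1 + a)^2 - b^2 = 1 + 2 * a + 2 * a^2 - (a^2 + b^2)"
    by (simp add: power2_eq_square algebra_simps)
  also have "\<dots> = (2 + 2 * a) * a"
    unfolding circle by (simp add: power2_eq_square algebra_simps)
  finally have re: "(1 + a)^2 - b^2 = s^2 * a"
    by (simp only: s)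
  have "2 * ((1 + a) * b) = (2 + 2 * a) * b"
    by (simp add: algebra_simps)
  then have im: "2 * ((1 + a) * b) = s^2 * b"
    by (simp only: s)
  have "quad_norm \<iota> (point ((1 + a) / s) (b / s)) = ((1 + a)^2 + b^2) / s^2"
    by (simp only: quad_norm_point power_divide add_divide_distrib[symmetric])
  then have "point ((1 + a) / s) (b / s) \<in> norm_1_group"
    using \<open>s \<noteq> 0\<close> by (simp add: norm norm_1_group_def)
  moreover have "(point ((1 + a) / s) (b / s))^2 =
    point (((1 + a)^2 - b^2) / s^2) (2 * ((1 + a) * b) / s^2)"
    by (simp add: point_mult power2_eq_square diff_divide_distrib mult.commute)
  then have "(point ((1 + a) / s) (b / s))^2 = point a b"
    using \<open>s \<noteq> 0\<close> by (simp only: re im) simp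
  ultimately show ?thesis
    by blast
qed

section \<open>The character of order eight on the norm-one group\<close>

context
  fixes M8 :: "'b \<Rightarrow> complex"
  assumes M8: "mult_char M8" and order_8: "char_order M8 = 8"
begin

lemma M8_power_4: "z \<noteq> 0 \<Longrightarrow> M8 z ^ 4 = quad_char (quad_norm \<iota> z)"
  using order_8_power_4[OF odd_card_ext M8 order_8] quad_char_quad_norm by simp

text \<open>The value \<open>M\<^sub>8(x)\<close> is killed by the exponent \<open>q - 1\<close>, which is \<open>2\<close> modulo \<open>4\<close>, and by \<open>4\<close>, as
  \<open>N(x) = x\<^sup>2\<close> is a square.\<close>
lemma M8_emb_square:
  assumes "x \<noteq> 0"
  shows "M8 (\<iota> x) ^ 2 = 1"
proof -
  obtain m where m: "CARD('a) = 4 * m + 3"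
    by (rule card_eq)
  have fourth: "M8 (\<iota> x) ^ 4 = 1"
    using M8_power_4[of "\<iota> x"] assms by (simp add: quad_norm_emb triv_char_def)
  have "M8 (\<iota> (x ^ (CARD('a) - 1))) = 1"
    using power_CARD_minus_1[OF assms] by (simp add: mult_char_1[OF M8])
  then have "M8 (\<iota> x) ^ (4 * m + 2) = 1"
    by (simp only: emb_power mult_char_power[OF M8]) (simp add: m)
  then show ?thesis
    by (simp add: power_add power_mult fourth power2_eq_square)
qed

text \<open>An explicit form of Hilbert 90: \<open>u = w / w\<^sup>q\<close> for \<open>w = 1 + u\<close>, provided \<open>u \<noteq> -1\<close>. So
  \<open>M\<^sub>8(u) = M\<^sub>8(w)\<^bsup>1 - q\<^esup>\<close>, and the square of this is \<open>M\<^sub>8(w)\<^sup>4\<close>, the quadratic character of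
  \<open>N(1 + u) = 2 + 2 a\<close>.\<close>
lemma M8_square_norm_1:
  assumes circle: "a^2 + b^2 = 1"
  shows "M8 (point a b) ^ 2 = (if a = -1 then 1 else quad_char (2 + 2 * a))"
proof (cases "a = -1")
  case True
  then have "b = 0" using circle by simp
  then show ?thesis
    using True M8_emb_square[of "-1"] by (simp add: emb_conv_point)
next
  case False
  define w where "w = point (1 + a) b"
  have "quad_norm \<iota> w = 1 + 2 * a + (a^2 + b^2)"
    by (simp add: w_def quad_norm_point power2_eq_square algebra_simps)
  then have norm_w: "quad_norm \<iota> w = 2 + 2 * a"
    by (simp add: circle)
  have "w \<noteq> 0"
    using False by (simp add: w_def point_eq_0_iff add_eq_0_iff)
  have "point a b * w ^ CARD('a) = point (a + (a^2 + b^2)) b"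
    by (simp add: w_def point_conj point_mult power2_eq_square algebra_simps)
  then have "point a b * w ^ CARD('a) = w"
    by (simp add: circle w_def add.commute)
  then have eq: "M8 (point a b) * M8 w ^ CARD('a) = M8 w"
    by (metis mult_char_mult[OF M8] mult_char_power[OF M8])
  obtain m where m: "CARD('a) = 4 * m + 3"
    by (rule card_eq)
  have eighth: "M8 w ^ 8 = 1"
    by (rule char_order_8(1)[OF M8 order_8 \<open>w \<noteq> 0\<close>])
  \<comment> \<open>Squaring gives \<open>M\<^sub>8(u)\<^sup>2 = M\<^sub>8(w)\<^bsup>2 - 2 q\<^esup>\<close>, and \<open>2 - 2 q\<close> is \<open>4\<close> modulo \<open>8\<close>.\<close>
  have "M8 (point a b) ^ 2 * (M8 w ^ CARD('a)) ^ 2 = M8 w ^ 2"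
    unfolding power_mult_distrib[symmetric] eq ..
  also have "(M8 w ^ CARD('a)) ^ 2 = (M8 w ^ 8) ^ m * M8 w ^ 6"
    by (simp add: m flip: power_mult power_add)
  finally have "M8 (point a b) ^ 2 * M8 w ^ 6 = M8 w ^ 2"
    by (simp add: eighth)
  then have "M8 (point a b) ^ 2 * M8 w ^ 6 * M8 w ^ 2 = M8 w ^ 2 * M8 w ^ 2"
    by simp
  then have "M8 (point a b) ^ 2 * M8 w ^ 8 = M8 w ^ 4"
    by (simp add: mult.assoc flip: power_add)
  then show ?thesis
    using False by (simp add: eighth M8_power_4[OF \<open>w \<noteq> 0\<close>] norm_w)
qed

text \<open>The sign \<open>M\<^sub>8(u)\<^sup>2\<close> separates the squares of the norm-one group, at which \<open>M\<^sub>8(u)\<close> is its own inverse,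
  from the other elements, at which the inverse is \<open>- M\<^sub>8(u)\<close>. Counting square roots covers both cases
  at once, so that a sum over the group can become a sum over square roots.\<close>
lemma M8_plus_inverse:
  assumes u: "u \<in> norm_1_group"
  shows "M8 u + M8 (inverse u) = of_nat (card {v \<in> norm_1_group. v^2 = u}) * M8 u"
proof (cases u rule: point_cases)
  case (point a b)
  have circle: "a^2 + b^2 = 1"
    using u by (simp add: point norm_1_group_def quad_norm_point)
  have "u \<noteq> 0"
    using norm_1_group_nonzero[OF u] .
  have inv: "M8 u * M8 (inverse u) = 1"
    using \<open>u \<noteq> 0\<close> by (simp add: mult_char_1[OF M8] flip: mult_char_mult[OF M8])
  show ?thesis
  proof (cases "\<exists>v\<in>norm_1_group. v^2 = u")
    \<comment> \<open>Then \<open>u\<close> has exactly two square roots, and \<open>M\<^sub>8(u) = M\<^sub>8(v)\<^sup>2 = \<plusminus>1\<close> is its own inverse.\<close>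
    case True
    then obtain v where v: "v \<in> norm_1_group" "v^2 = u" by blast
    have "-v \<in> norm_1_group"
      using v(1) quad_norm_mult[of "-1" v] quad_norm_emb[of "-1"]
      by (simp add: norm_1_group_def emb_minus)
    moreover have "{w. w^2 = u} = {v, -v}"
      unfolding v(2)[symmetric] by (rule square_roots_eq)
    ultimately have roots: "{w \<in> norm_1_group. w^2 = u} = {w. w^2 = u}"
      using v(1) by auto
    have "quad_char u = 1"
      using v(2) \<open>u \<noteq> 0\<close> by (auto simp: quad_char_def)
    then have "of_nat (card {w \<in> norm_1_group. w^2 = u}) = (2 :: complex)"
      unfolding roots using card_square_roots[OF odd_card_ext, of u] by simp
    moreover have "M8 u ^ 2 = 1"
    proof (cases v rule: point_cases)
      case (point c d)
      then have "c^2 + d^2 = 1"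
        using v(1) by (simp add: norm_1_group_def quad_norm_point)
      from M8_square_norm_1[OF this] have "M8 u = (if c = -1 then 1 else quad_char (2 + 2 * c))"
        by (simp add: point mult_char_power[OF M8] flip: v(2))
      moreover have "M8 u \<noteq> 0"
        by (rule mult_char_nonzero[OF M8 \<open>u \<noteq> 0\<close>])
      ultimately show ?thesis
        by (auto simp: quad_char_def split: if_splits)
    qed
    then have "M8 (inverse u) = M8 u"
      using inv mult_char_nonzero[OF M8 \<open>u \<noteq> 0\<close>]
      by (simp add: power2_eq_square) (metis mult_left_cancel)
    ultimately show ?thesis
      by simp
  next
    \<comment> \<open>Then \<open>M\<^sub>8(u)\<^sup>2 = -1\<close>, so that \<open>M\<^sub>8(u)\<close> and its inverse add up to \<open>0\<close>.\<close>
    case False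
    then have char: "a \<noteq> -1" "quad_char (2 + 2 * a) \<noteq> 1"
      using norm_1_group_square[OF circle] by (auto simp: point)
    have "M8 u ^ 2 \<noteq> 0"
      using mult_char_nonzero[OF M8 \<open>u \<noteq> 0\<close>] by simp
    then have "M8 u ^ 2 = -1"
      using M8_square_norm_1[OF circle] char by (auto simp: point quad_char_def split: if_splits)
    then have "M8 u * (M8 u + M8 (inverse u)) = 0"
      by (simp add: distrib_left inv flip: power2_eq_square)
    moreover have "{v \<in> norm_1_group. v^2 = u} = {}"
      using False by auto
    ultimately show ?thesis
      using mult_char_nonzero[OF M8 \<open>u \<noteq> 0\<close>] by simp
  qed
qed

text \<open>Since \<open>H\<close> does not distinguish \<open>u\<close> from \<open>1/u\<close>, each value \<open>M\<^sub>8(u)\<close> may be averaged with its inverse.\<close>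
lemma sum_norm_1_group_squares:
  fixes H :: "'b \<Rightarrow> complex"
  assumes H: "\<And>u. u \<in> norm_1_group \<Longrightarrow> H (inverse u) = H u"
  shows "2 * (\<Sum>u\<in>norm_1_group. M8 u * H u) = (\<Sum>v\<in>norm_1_group. M8 v ^ 2 * H (v^2))"
proof -
  have inv: "inverse u \<in> norm_1_group" if "u \<in> norm_1_group" for u
  proof -
    have "quad_norm \<iota> (u * inverse u) = 1"
      using norm_1_group_nonzero[OF that] quad_norm_emb[of 1] by simp
    then show ?thesis
      using that by (simp add: norm_1_group_def quad_norm_mult)
  qed
  have "(\<Sum>u\<in>norm_1_group. M8 u * H u) = (\<Sum>u\<in>norm_1_group. M8 (inverse u) * H u)"
    by (rule sum.reindex_bij_witness[of _ inverse inverse]) (auto simp: inv H)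
  then have "2 * (\<Sum>u\<in>norm_1_group. M8 u * H u) =
    (\<Sum>u\<in>norm_1_group. (M8 u + M8 (inverse u)) * H u)"
    by (simp add: distrib_right sum.distrib)
  also have "\<dots> = (\<Sum>u\<in>norm_1_group. \<Sum>v | v \<in> norm_1_group \<and> v^2 = u. M8 (v^2) * H (v^2))"
    by (intro sum.cong refl) (simp add: M8_plus_inverse)
  also have "\<dots> = (\<Sum>v\<in>norm_1_group. M8 (v^2) * H (v^2))"
    by (rule sum.group) (auto simp: norm_1_group_def power2_eq_square quad_norm_mult)
  finally show ?thesis
    by (simp add: mult_char_power[OF M8])
qed

text \<open>The substitution is \<open>z = j\<^sup>2 u\<close>, which works because \<open>N(j\<^sup>2) = j\<^sup>4\<close> and \<open>M\<^sub>8(j\<^sup>2) = 1\<close>.\<close>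
lemma R_sum_norm_1_group:
  assumes "j \<noteq> 0"
  shows "R_sum \<iota> M8 D j = (\<Sum>u\<in>norm_1_group. M8 u * char_conj D (quad_norm \<iota> (1 - \<iota> (j^2) * u)))"
  unfolding R_sum_def
proof (rule sum.reindex_bij_witness[of _ "\<lambda>u. \<iota> (j^2) * u" "\<lambda>z. z / \<iota> (j^2)"])
  fix z assume z: "z \<in> {z. quad_norm \<iota> z = j^4}"
  have eq: "\<iota> (j^2) * (z / \<iota> (j^2)) = z"
    using assms by simp
  from eq show "\<iota> (j^2) * (z / \<iota> (j^2)) = z" .
  have "(j^2)^2 * quad_norm \<iota> (z / \<iota> (j^2)) = j^4"
    using z arg_cong[OF eq, of "quad_norm \<iota>"] by (simp only: quad_norm_mult quad_norm_emb) simp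
  then show "z / \<iota> (j^2) \<in> norm_1_group"
    using assms by (simp add: norm_1_group_def flip: power_mult)
  have "M8 (\<iota> (j^2)) = 1"
    using M8_emb_square[OF assms] by (simp add: emb_power mult_char_power[OF M8])
  then have "M8 (z / \<iota> (j^2)) = M8 z"
    using arg_cong[OF eq, of M8] by (simp only: mult_char_mult[OF M8]) simp
  then show "M8 (z / \<iota> (j^2)) * char_conj D (quad_norm \<iota> (1 - \<iota> (j^2) * (z / \<iota> (j^2)))) =
    M8 z * char_conj D (quad_norm \<iota> (1 - z))"
    by (simp only: eq)
qed (use assms in \<open>auto simp: norm_1_group_def quad_norm_mult quad_norm_emb simp flip: power_mult\<close>)

theorem R_sum_eq_base_field_sum:
  assumes "j \<noteq> 0"
  shows "R_sum \<iota> M8 D j =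
    (\<Sum>a\<in>UNIV. quad_char (2 + 2 * a) * char_conj D ((1 + j^2)^2 - 4 * j^2 * a^2))"
proof -
  define H where "H u = char_conj D (quad_norm \<iota> (1 - \<iota> (j^2) * u))" for u
  define h where "h a = char_conj D ((1 + j^2)^2 - 4 * j^2 * a^2)" for a
  define \<chi> where "\<chi> a = (if a = -1 then 1 else quad_char (2 + 2 * a))" for a :: 'a
  have H_inverse: "H (inverse u) = H u" if "u \<in> norm_1_group" for u
    using that
    by (cases u rule: point_cases)
      (simp add: norm_1_group_def H_def quad_norm_point inverse_norm_1 quad_norm_one_minus)
  have "2 * R_sum \<iota> M8 D j = 2 * (\<Sum>u\<in>norm_1_group. M8 u * H u)"
    by (simp add: R_sum_norm_1_group[OF assms] H_def)
  also have "\<dots> = (\<Sum>v\<in>norm_1_group. M8 v ^ 2 * H (v^2))"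
    by (rule sum_norm_1_group_squares[of H, OF H_inverse])
  also have "\<dots> = (\<Sum>(a, b)\<in>unit_circle. M8 (point a b) ^ 2 * H ((point a b)^2))"
    by (rule sum_norm_1_group)
  also have "\<dots> = (\<Sum>(a, b)\<in>unit_circle. \<chi> a * h a)"
  proof (intro sum.cong refl, clarify)
    fix a b :: 'a assume "(a, b) \<in> unit_circle"
    then have circle: "a^2 + b^2 = 1"
      by (simp add: unit_circle_def)
    have "(a^2 - b^2)^2 + (2 * a * b)^2 = (a^2 + b^2)^2"
      by (simp add: power2_eq_square algebra_simps)
    then have circle2: "(a^2 - b^2)^2 + (2 * a * b)^2 = 1"
      by (simp add: circle)
    have "a^2 - b^2 = 2 * a^2 - (a^2 + b^2)"
      by simp
    then have re: "a^2 - b^2 = 2 * a^2 - 1"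
      by (simp only: circle)
    have "(point a b)^2 = point (a^2 - b^2) (2 * a * b)"
      by (simp add: point_mult power2_eq_square)
    then have "H ((point a b)^2) = char_conj D (1 - 2 * j^2 * (a^2 - b^2) + j^4)"
      by (simp add: H_def quad_norm_one_minus[OF circle2])
    also have "1 - 2 * j^2 * (a^2 - b^2) + j^4 = (1 + j^2)^2 - 4 * j^2 * a^2"
      unfolding re by (simp add: power2_eq_square power4_eq_xxxx algebra_simps)
    finally show "M8 (point a b) ^ 2 * H ((point a b)^2) = \<chi> a * h a"
      by (simp add: M8_square_norm_1[OF circle] \<chi>_def h_def)
  qed
  also have "\<dots> = (\<Sum>a\<in>UNIV. (1 + quad_char (1 - a^2)) * (\<chi> a * h a))"
    by (rule sum_unit_circle[OF odd_card])
  \<comment> \<open>The point \<open>-1\<close>, where \<open>\<chi>\<close> is \<open>1\<close> rather than \<open>\<phi>(0) = 0\<close>, supplies the term that the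
    symmetrization takes away.\<close>
  also have "\<dots> = (\<Sum>a\<in>UNIV. (1 + quad_char (1 - a^2)) * (quad_char (2 + 2 * a) * h a) +
      (if a = -1 then h a else 0))"
    by (intro sum.cong) (auto simp: \<chi>_def)
  also have "\<dots> = (\<Sum>a\<in>UNIV. (1 + quad_char (1 - a^2)) * (quad_char (2 + 2 * a) * h a)) + h 1"
    by (simp add: sum.distrib h_def)
  also have "\<dots> = 2 * (\<Sum>a\<in>UNIV. quad_char (2 + 2 * a) * h a)"
    by (subst sum_even_quad_char[OF odd_card]) (simp_all add: h_def)
  finally show ?thesis
    by (simp add: h_def)
qed

end

end

section \<open>Evaluation of the sum\<close>

theorem theorem4p1:
  fixes \<iota> :: "'a::{field,finite} \<Rightarrow> 'b::{field,finite}"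
    and M8 :: "'b \<Rightarrow> complex"
    and D :: "'a \<Rightarrow> complex"
    and p k q :: nat
    and j :: 'a
  assumes "prime p" and "odd p" and "k \<ge> 1" and "q = p ^ k" and "q mod 4 = 3"
    and "CARD('a) = q" and "CARD('b) = q ^ 2"
    and "field_embedding \<iota>"
    and "mult_char M8" and "char_order M8 = 8"
    and "mult_char D"
    and "j \<noteq> 0"
  shows "((j = 1 \<or> j = - 1) \<longrightarrow>
           R_sum \<iota> M8 D j =
             - char_conj D 4 * jacobi_sum (char_mult quad_char (char_pow D 2)) quad_char) \<and>
         ((j \<noteq> 1 \<and> j \<noteq> - 1) \<longrightarrow>
           R_sum \<iota> M8 D j =
             - quad_char j * of_nat q * char_pow (char_conj D) 4 (j - 1) *
               hyp2F1 D (char_mult (char_pow D 2) quad_char) (char_mult D quad_char)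
                 (- (((j + 1) / (j - 1)) ^ 2)))"
proof -
  have mod_4: "CARD('a) mod 4 = 3"
    using assms by simp
  then have odd: "odd CARD('a)"
    by presburger
  \<comment> \<open>Since \<open>q\<^sup>2 mod 8 = 1\<close>, Euler's criterion makes \<open>-1\<close> a square in the extension.\<close>
  obtain i :: 'b where i: "i^2 = -1"
  proof -
    obtain m where "q = 4 * m + 3"
      using \<open>q mod 4 = 3\<close> by (metis mult_div_mod_eq)
    then have "CARD('b) = 2 * (2 * (4 * m^2 + 6 * m + 2)) + 1"
      using \<open>CARD('b) = q^2\<close> by (simp add: power2_eq_square algebra_simps)
    then have "odd CARD('b)" "even ((CARD('b) - 1) div 2)"
      by simp_all
    then have "\<exists>y::'b. -1 = y^2"
      using euler_criterion[of "-1 :: 'b"] by simp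
    then show thesis
      using that by metis
  qed
  interpret gaussian_extension \<iota> i
  proof
    have "CARD('b) = p ^ (2 * k)"
      using assms by (simp add: mult.commute flip: power_mult)
    then show "(x + y) ^ CARD('a) = x ^ CARD('a) + y ^ CARD('a)" for x y :: 'b
      using assms frobenius_add_prime_power by metis
  qed (use assms mod_4 i in auto)
  note R_sum = R_sum_eq_base_field_sum[OF \<open>mult_char M8\<close> \<open>char_order M8 = 8\<close> \<open>j \<noteq> 0\<close>, of D]
  note conj = mult_char_char_conj[OF \<open>mult_char D\<close>]
  show ?thesis
  proof (intro conjI impI)
    assume "j = 1 \<or> j = - 1"
    then have "(1 + j^2)^2 - 4 * j^2 * a^2 = 4 * (1 - a^2)" for a
      by (auto simp: algebra_simps)
    then have "R_sum \<iota> M8 D j =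
      char_conj D 4 * (\<Sum>a\<in>UNIV. quad_char (2 + 2 * a) * char_conj D (1 - a^2))"
      by (simp only: R_sum mult_char_mult[OF conj]) (simp add: sum_distrib_left mult_ac)
    then show "R_sum \<iota> M8 D j =
        - char_conj D 4 * jacobi_sum (char_mult quad_char (char_pow D 2)) quad_char"
      by (simp add: sum_quad_char_doubling[OF odd conj] jacobi_sum_eq[OF mod_4 \<open>mult_char D\<close>])
  next
    assume "j \<noteq> 1 \<and> j \<noteq> - 1"
    then show "R_sum \<iota> M8 D j =
        - quad_char j * of_nat q * char_pow (char_conj D) 4 (j - 1) *
          hyp2F1 D (char_mult (char_pow D 2) quad_char) (char_mult D quad_char)
            (- (((j + 1) / (j - 1)) ^ 2))"
      using hyp2F1_eq[OF mod_4 \<open>mult_char D\<close> \<open>j \<noteq> 0\<close>] \<open>CARD('a) = q\<close> by (simp add: R_sum)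
  qed
qed

end
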